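(* Let $H$ be an infinite-dimensional (complex) Hilbert space and let $f\in \mathbb C\langle \mathcal X\rangle$ be a nonconstant polynomial. Then every element in $A=B(H)$ is a sum of $3916$ elements from $f(A)-f(A)$.
   Context: $\mathbb C\langle \mathcal X\rangle$ is the free (unital, associative) algebra over $\mathbb C$ on $\mathcal X=\{X_1,X_2,\dots\}$, i.e. the algebra of noncommutative polynomials. $B(H)$ is the algebra of all bounded linear operators on $H$. For $f=f(X_1,\dots,X_m)$, $f(A)=\{f(a_1,\dots,a_m)\mid a_1,\dots,a_m\in A\}$ and $f(A)-f(A)=\{t-t'\mid t,t'\in f(A)\}$. *)

theory Defs
  imports "HOL-Analysis.Analysis" "HOL-Library.Poly_Mapping"
begin

class complex_vector = ab_group_add +
  fixes scaleC :: "complex \<Rightarrow> 'a \<Rightarrow> 'a" (infixr "*\<^sub>C" 75)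
  assumes scaleC_add_right: "a *\<^sub>C (x + y) = a *\<^sub>C x + a *\<^sub>C y"
    and scaleC_add_left: "(a + b) *\<^sub>C x = a *\<^sub>C x + b *\<^sub>C x"
    and scaleC_scaleC: "a *\<^sub>C b *\<^sub>C x = (a * b) *\<^sub>C x"
    and scaleC_one: "1 *\<^sub>C x = x"

global_interpretation complex_vector:
  vector_space "scaleC :: complex \<Rightarrow> 'a \<Rightarrow> 'a::complex_vector"
  defines cspan = complex_vector.span
  by unfold_locales
     (simp_all add: scaleC_add_right scaleC_add_left scaleC_scaleC scaleC_one)

text \<open>
  The axiom \<open>scaleR_scaleC\<close> ties the real structure inherited from
  \<^class>\<open>real_normed_vector\<close> to the complex one. The inner product is linear in
  its first argument.
\<close>

class complex_inner = complex_vector + real_normed_vector +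
  fixes cinner :: "'a \<Rightarrow> 'a \<Rightarrow> complex"
  assumes scaleR_scaleC: "r *\<^sub>R x = complex_of_real r *\<^sub>C x"
    and cinner_commute: "cinner x y = cnj (cinner y x)"
    and cinner_add_left: "cinner (x + y) z = cinner x z + cinner y z"
    and cinner_scaleC_left: "cinner (c *\<^sub>C x) y = c * cinner x y"
    and cinner_ge_zero: "0 \<le> Re (cinner x x)"
    and cinner_eq_zero_iff: "cinner x x = 0 \<longleftrightarrow> x = 0"
    and norm_eq_sqrt_cinner: "norm x = sqrt (Re (cinner x x))"

class chilbert_space = complex_inner + complete_space

definition cfinite_dim :: "'a::complex_vector set \<Rightarrow> bool"
  where "cfinite_dim V \<longleftrightarrow> (\<exists>B. finite B \<and> B \<subseteq> V \<and> V \<subseteq> cspan B)"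


text \<open>
  Unital associative complex algebras. The zero algebra is not excluded, so that
  the bounded operators on every Hilbert space form an instance.
\<close>

class complex_algebra = complex_vector + ring + monoid_mult +
  assumes mult_scaleC_left: "(c *\<^sub>C x) * y = c *\<^sub>C (x * y)"
    and mult_scaleC_right: "x * (c *\<^sub>C y) = c *\<^sub>C (x * y)"

definition bounded_clinear :: "('a::complex_inner \<Rightarrow> 'b::complex_inner) \<Rightarrow> bool"
  where "bounded_clinear T \<longleftrightarrow> bounded_linear T \<and> (\<forall>c x. T (c *\<^sub>C x) = c *\<^sub>C T x)"

typedef (overloaded) 'h bounded_op = "{T :: 'h::chilbert_space \<Rightarrow> 'h. bounded_clinear T}"
  morphisms apply_op Abs_op
  by (rule exI[of _ "\<lambda>_. 0"]) (simp add: bounded_clinear_def bounded_linear_zero)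

setup_lifting type_definition_bounded_op

lemma scaleC_as_bounded_linear:
  "bounded_linear (\<lambda>x. c *\<^sub>C (x :: 'a::complex_inner))"
proof (rule bounded_linear_intro[where K = "cmod c"])
  fix x y :: 'a and r :: real
  show "c *\<^sub>C (x + y) = c *\<^sub>C x + c *\<^sub>C y"
    by (rule scaleC_add_right)
  show "c *\<^sub>C (r *\<^sub>R x) = r *\<^sub>R (c *\<^sub>C x)"
    by (simp add: scaleR_scaleC scaleC_scaleC mult.commute)
  have *: "cinner (c *\<^sub>C x) (c *\<^sub>C x) = complex_of_real ((cmod c)\<^sup>2) * cinner x x"
  proof -
    have "cinner x (c *\<^sub>C x) = cnj c * cinner x x"
      by (subst cinner_commute, subst cinner_scaleC_left, subst (2) cinner_commute) simp
    then show ?thesis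
      using complex_norm_square[of c] by (simp add: cinner_scaleC_left)
  qed
  show "norm (c *\<^sub>C x) \<le> norm x * cmod c"
    unfolding norm_eq_sqrt_cinner * by (simp add: real_sqrt_mult)
qed

instantiation bounded_op :: (chilbert_space) complex_algebra
begin

lift_definition zero_bounded_op :: "'a bounded_op" is "\<lambda>_. 0"
  by (simp add: bounded_clinear_def bounded_linear_zero)

lift_definition plus_bounded_op :: "'a bounded_op \<Rightarrow> 'a bounded_op \<Rightarrow> 'a bounded_op"
  is "\<lambda>S T x. S x + T x"
  by (simp add: bounded_clinear_def bounded_linear_add scaleC_add_right)

lift_definition minus_bounded_op :: "'a bounded_op \<Rightarrow> 'a bounded_op \<Rightarrow> 'a bounded_op"
  is "\<lambda>S T x. S x - T x"
  by (simp add: bounded_clinear_def bounded_linear_sub complex_vector.scale_right_diff_distrib)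

lift_definition uminus_bounded_op :: "'a bounded_op \<Rightarrow> 'a bounded_op"
  is "\<lambda>T x. - T x"
  by (simp add: bounded_clinear_def bounded_linear_minus)

lift_definition one_bounded_op :: "'a bounded_op" is "\<lambda>x. x"
  by (simp add: bounded_clinear_def)

lift_definition times_bounded_op :: "'a bounded_op \<Rightarrow> 'a bounded_op \<Rightarrow> 'a bounded_op"
  is "\<lambda>S T x. S (T x)"
  by (simp add: bounded_clinear_def bounded_linear_compose)

lift_definition scaleC_bounded_op :: "complex \<Rightarrow> 'a bounded_op \<Rightarrow> 'a bounded_op"
  is "\<lambda>c T x. c *\<^sub>C T x"
  by (simp add: bounded_clinear_def bounded_linear_compose[OF scaleC_as_bounded_linear]
      scaleC_scaleC mult.commute)

instance
proof
  fix R S T :: "'a bounded_op" and c d :: complex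
  show "R * (S + T) = R * S + R * T"
    by transfer (simp add: bounded_clinear_def linear_simps fun_eq_iff)
  show "S * (c *\<^sub>C T) = c *\<^sub>C (S * T)"
    by transfer (simp add: bounded_clinear_def fun_eq_iff)
qed (transfer; simp add: fun_eq_iff scaleC_add_right scaleC_add_left scaleC_scaleC scaleC_one
      add.assoc; fail | transfer; simp add: fun_eq_iff add.commute; fail)+

end


text \<open>
  The free algebra is the monoid algebra of the free monoid: finitely supported
  functions from words to \<^typ>\<open>complex\<close> with the convolution product supplied by
  \<^theory>\<open>HOL-Library.Poly_Mapping\<close>. That theory expects the monoid of exponents to
  be written additively, so concatenation of words is \<open>+\<close> and the empty word is \<open>0\<close>.
  The natural number \<open>i\<close> stands for the \<open>(i + 1)\<close>-st indeterminate.
\<close>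

datatype 'x word = Word (letters: "'x list")

instantiation word :: (type) monoid_add
begin

definition "0 = Word []"

definition "v + w = Word (letters v @ letters w)"

instance
  by standard (simp_all add: zero_word_def plus_word_def)

end

type_synonym ncpoly = "nat word \<Rightarrow>\<^sub>0 complex"

definition ncvar :: "nat \<Rightarrow> ncpoly"
  where "ncvar i = Poly_Mapping.single (Word [i]) 1"

definition ncconst :: "complex \<Rightarrow> ncpoly"
  where "ncconst c = Poly_Mapping.single 0 c"

definition nonconstant :: "ncpoly \<Rightarrow> bool"
  where "nonconstant f \<longleftrightarrow> f \<notin> range ncconst"

definition nceval :: "(nat \<Rightarrow> 'a::complex_algebra) \<Rightarrow> ncpoly \<Rightarrow> 'a"
  where "nceval a f =
    (\<Sum>w\<in>Poly_Mapping.keys f. Poly_Mapping.lookup f w *\<^sub>C prod_list (map a (letters w)))"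

text \<open>
  Although \<open>nceval\<close> takes a value for each of the infinitely many indeterminates,
  only the finitely many that occur in \<open>f\<close> matter. So letting the assignment range over
  all sequences yields the same set of values as letting \<open>(a\<^sub>1, \<dots>, a\<^sub>m)\<close>
  range over all tuples, for any \<open>m\<close> with \<open>f = f(X\<^sub>1, \<dots>, X\<^sub>m)\<close>.
\<close>

lemma nceval_cong:
  assumes "\<And>w i. w \<in> Poly_Mapping.keys f \<Longrightarrow> i \<in> set (letters w) \<Longrightarrow> a i = b i"
  shows "nceval a f = nceval b f"
proof -
  have "map a (letters w) = map b (letters w)" if "w \<in> Poly_Mapping.keys f" for w
    using assms that by (simp cong: map_cong)
  then show ?thesis
    unfolding nceval_def by (intro sum.cong refl) (simp only:)
qed

definition ncimage :: "ncpoly \<Rightarrow> 'a::complex_algebra set"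
  where "ncimage f = {nceval a f |a. True}"

lemma nceval_superset:
  assumes "finite W" "Poly_Mapping.keys f \<subseteq> W"
  shows "nceval a f =
    (\<Sum>w\<in>W. Poly_Mapping.lookup f w *\<^sub>C prod_list (map a (letters w)))"
  unfolding nceval_def
  using assms by (intro sum.mono_neutral_left) (auto simp: in_keys_iff)

lemma nceval_single:
  "nceval a (Poly_Mapping.single w c) = c *\<^sub>C prod_list (map a (letters w))"
  by (simp add: nceval_def)

lemma nceval_add: "nceval a (f + g) = nceval a f + nceval a g"
proof -
  let ?W = "Poly_Mapping.keys f \<union> Poly_Mapping.keys g"
  have "Poly_Mapping.keys (f + g) \<subseteq> ?W"
    by (rule Poly_Mapping.keys_add)
  then show ?thesis
    by (simp add: nceval_superset[where W = ?W] lookup_add scaleC_add_left sum.distrib)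
qed

lemma nceval_const: "nceval a (ncconst c) = c *\<^sub>C 1"
  by (simp add: ncconst_def nceval_single zero_word_def)

lemma nceval_var: "nceval a (ncvar i) = a i"
  by (simp add: ncvar_def nceval_single scaleC_one)

lemma ncpoly_induct [case_names zero single_add]:
  fixes f :: ncpoly
  assumes zero: "P 0"
    and single_add: "\<And>w c f. P f \<Longrightarrow> P (Poly_Mapping.single w c + f)"
  shows "P f"
proof (induction f rule: Poly_Mapping.update_induct)
  case const
  show ?case by (rule zero)
next
  case (update f w c)
  have "Poly_Mapping.update w c f = Poly_Mapping.single w c + f"
    using update(1)
    by (intro poly_mapping_eqI) (auto simp: lookup_add lookup_update lookup_single in_keys_iff)
  with single_add[OF update(3)] show ?case by simp
qed

lemma nceval_mult: "nceval a (f * g) = nceval a f * nceval a g"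
proof (induction f rule: ncpoly_induct)
  case zero
  show ?case by (simp add: nceval_def)
next
  case (single_add v c f)
  have "nceval a (Poly_Mapping.single v c * g) = nceval a (Poly_Mapping.single v c) * nceval a g"
  proof (induction g rule: ncpoly_induct)
    case zero
    show ?case by (simp add: nceval_def)
  next
    case (single_add w d g)
    then show ?case
      by (simp add: distrib_left nceval_add mult_single nceval_single plus_word_def
          mult_scaleC_left mult_scaleC_right scaleC_scaleC)
  qed
  with single_add show ?case
    by (simp add: distrib_right nceval_add)
qed

end

theory Submission
  imports Defs
begin

text \<open>
  Let \<open>w\<close> be a shortest nonempty word of \<open>f\<close>, of length \<open>d\<close>, and let \<open>e\<^sub>i\<^sub>j\<close> be matrix units in
  \<open>B(H)\<close>. Sending \<open>X\<^sub>k\<close> to the sum of those \<open>e\<^sub>j\<^sub>,\<^sub>j\<^sub>+\<^sub>1\<close> with \<open>j < d\<close> for which the \<open>j\<close>-th letter of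
  \<open>w\<close> is \<open>X\<^sub>k\<close> annihilates every other nonempty word of \<open>f\<close>, so \<open>f\<close> takes a value \<open>c + \<mu> e\<^sub>0\<^sub>d\<close> with
  \<open>\<mu> \<noteq> 0\<close>. Subtracting a conjugate of this value shows that \<open>f(A) - f(A)\<close> contains a whole
  off-diagonal block, hence, being invariant under similarity, all off-diagonal blocks. A
  difference of two equal diagonal blocks is then a sum of three elements of \<open>f(A) - f(A)\<close>, and
  a single diagonal block \<open>y\<close> is a sum of six, by an Eilenberg swindle: the infinite
  amplification \<open>z = diag(y, y, \<dots>)\<close> satisfies \<open>z = diag(y, z)\<close>. Splitting \<open>T\<close> into
  \<open>4 \<times> 4\<close> blocks, at most \<open>16 \<cdot> 6 = 96\<close> summands suffice.
\<close>

section \<open>Sums of elements of similarity-invariant sets\<close>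

definition sums_of :: "nat \<Rightarrow> 'a::comm_monoid_add set \<Rightarrow> 'a set"
  where "sums_of n D = {\<Sum>i<n. g i |g. \<forall>i<n. g i \<in> D}"

lemma sums_of_0: "0 \<in> sums_of 0 D"
  by (simp add: sums_of_def)

lemma sums_of_1: "x \<in> D \<Longrightarrow> x \<in> sums_of 1 D"
  unfolding sums_of_def by (auto intro!: exI[of _ "\<lambda>_. x"])

lemma sums_of_add:
  assumes "x \<in> sums_of m D" "y \<in> sums_of n D"
  shows "x + y \<in> sums_of (m + n) D"
proof -
  obtain g h where g: "\<forall>i<m. g i \<in> D" "x = (\<Sum>i<m. g i)"
    and h: "\<forall>i<n. h i \<in> D" "y = (\<Sum>i<n. h i)"
    using assms by (auto simp: sums_of_def)
  define k where "k i = (if i < m then g i else h (i - m))" for i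
  have "(\<Sum>i<m + l. k i) = (\<Sum>i<m. g i) + (\<Sum>i<l. h i)" for l
    by (induction l) (simp_all add: k_def add.assoc)
  moreover have "\<forall>i<m + n. k i \<in> D"
    using g(1) h(1) by (simp add: k_def)
  ultimately show ?thesis
    unfolding sums_of_def using g(2) h(2) by (auto intro!: exI[of _ k])
qed

lemma sums_of_mono:
  assumes "x \<in> sums_of m D" "m \<le> n" "0 \<in> D"
  shows "x \<in> sums_of n D"
proof -
  have "0 \<in> sums_of (n - m) D"
    unfolding sums_of_def using assms(3) by (auto intro!: exI[of _ "\<lambda>_. 0"])
  from sums_of_add[OF assms(1) this] show ?thesis
    using assms(2) by simp
qed

lemma sums_of_sum:
  assumes "finite I" "\<And>i. i \<in> I \<Longrightarrow> g i \<in> sums_of n D"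
  shows "sum g I \<in> sums_of (card I * n) D"
  using assms by (induction I rule: finite_induct) (auto simp: sums_of_0 intro!: sums_of_add)

text \<open>The elements \<open>P i * y * Q j\<close> behave like matrices whose only entry is
  \<open>y\<close> at position \<open>(i, j)\<close>. The index type may be infinite, and the
  idempotents \<open>P i * Q i\<close> need not add up to 1.\<close>

definition dual_family :: "('i \<Rightarrow> 'a::complex_algebra) \<Rightarrow> ('i \<Rightarrow> 'a) \<Rightarrow> bool"
  where "dual_family P Q \<longleftrightarrow> (\<forall>i j. Q i * P j = (if i = j then 1 else 0))"

lemma dual_family_simps:
  assumes "dual_family P Q"
  shows "Q i * P j = (if i = j then 1 else 0)" "Q i * (P j * x) = (if i = j then x else 0)"
proof -
  show *: "Q i * P j = (if i = j then 1 else 0)"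
    using assms by (simp add: dual_family_def)
  show "Q i * (P j * x) = (if i = j then x else 0)"
    unfolding mult.assoc[symmetric] * by simp
qed

section \<open>Moving matrix blocks by similarity\<close>

locale similarity_invariant =
  fixes D :: "'a::complex_algebra set"
  assumes zero_mem: "0 \<in> D"
    and uminus_mem: "x \<in> D \<Longrightarrow> - x \<in> D"
    and conjugate_mem: "s * s' = 1 \<Longrightarrow> s' * s = 1 \<Longrightarrow> x \<in> D \<Longrightarrow> s * x * s' \<in> D"
begin

text \<open>Makes conjugation available for sums of \<open>n\<close> elements, so that a block
  already written as such a sum can be moved without further summands.\<close>

lemma similarity_invariant_sums_of: "similarity_invariant (sums_of n D)"
proof
  show "0 \<in> sums_of n D"
    by (rule sums_of_mono[OF sums_of_0]) (simp_all add: zero_mem)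
next
  fix x assume "x \<in> sums_of n D"
  then obtain g where "\<forall>i<n. g i \<in> D" "x = (\<Sum>i<n. g i)"
    by (auto simp: sums_of_def)
  then show "- x \<in> sums_of n D"
    unfolding sums_of_def
    by (auto intro!: exI[of _ "\<lambda>i. - g i"] uminus_mem simp: sum_negf)
next
  fix s s' x :: 'a assume s: "s * s' = 1" "s' * s = 1" and "x \<in> sums_of n D"
  then obtain g where "\<forall>i<n. g i \<in> D" "x = (\<Sum>i<n. g i)"
    by (auto simp: sums_of_def)
  then show "s * x * s' \<in> sums_of n D"
    unfolding sums_of_def
    by (auto intro!: exI[of _ "\<lambda>i. s * g i * s'"] conjugate_mem[OF s]
        simp: sum_distrib_left sum_distrib_right)
qed

lemma sums_of_diff:
  assumes "x \<in> sums_of m D" "y \<in> sums_of n D"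
  shows "x - y \<in> sums_of (m + n) D"
  using sums_of_add[OF assms(1) similarity_invariant.uminus_mem[OF similarity_invariant_sums_of assms(2)]]
  by simp

text \<open>A transposition matrix is its own inverse and acts on the row and the column index of a
  block at once, so relabelling costs no summand.\<close>

lemma transpose_mem:
  assumes fam: "dual_family P Q" and "i \<noteq> j" and mem: "P k * y * Q l \<in> D"
  defines "\<tau> \<equiv> id(i := j, j := i)"
  shows "P (\<tau> k) * y * Q (\<tau> l) \<in> D"
proof -
  note qp = dual_family_simps[OF fam]
  \<comment> \<open>the permutation matrix exchanging \<open>i\<close> and \<open>j\<close>, written so that \<open>P\<close> and \<open>Q\<close> need not satisfy \<open>\<Sum>i. P i * Q i = 1\<close>\<close>
  define s where "s = 1 - (P i - P j) * (Q i - Q j)"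
  have sP: "s * P k = P (\<tau> k)" for k
    using \<open>i \<noteq> j\<close> by (simp add: s_def \<tau>_def algebra_simps qp)
  have Qs: "Q k * s = Q (\<tau> k)" for k
    using \<open>i \<noteq> j\<close> by (simp add: s_def \<tau>_def algebra_simps qp)
  have "s * s = 1"
    using \<open>i \<noteq> j\<close> by (simp add: s_def algebra_simps qp)
  from conjugate_mem[OF this this mem] show ?thesis
    by (simp add: mult.assoc Qs sP flip: mult.assoc[of s])
qed

text \<open>Transpositions act transitively on the ordered pairs of distinct indices, so one
  off-diagonal position yields all others.\<close>

lemma off_diagonal_mem:
  assumes fam: "dual_family P Q" and "i \<noteq> j" and mem: "\<And>y. P i * y * Q j \<in> D"
    and "i' \<noteq> j'"
  shows "P i' * y * Q j' \<in> D"
proof -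
  \<comment> \<open>Swapping \<open>k\<close> and \<open>k'\<close> fixes the column
    \<open>l\<close>, which differs from both.\<close>
  have left: "P k' * y * Q l \<in> D" if "P k * y * Q l \<in> D" "k \<noteq> l" "k' \<noteq> l" for k k' l
    using transpose_mem[OF fam, of k k' k y l] that by (cases "k = k'") (auto simp: fun_upd_def)
  have right: "P k * y * Q l' \<in> D" if "P k * y * Q l \<in> D" "k \<noteq> l" "k \<noteq> l'" for k l l'
    using transpose_mem[OF fam, of l l' k y l] that by (cases "l = l'") (auto simp: fun_upd_def)
  show ?thesis
  proof (cases "i' = j")
    case True
    \<comment> \<open>The row cannot move to \<open>j\<close> while the column is still
      \<open>j\<close>; row and column are exchanged first.\<close>
    have "P j * y * Q i \<in> D"
      using transpose_mem[OF fam \<open>i \<noteq> j\<close> mem[of y]] \<open>i \<noteq> j\<close> by simp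
    then show ?thesis
      using right[of j i j'] True \<open>i \<noteq> j\<close> \<open>i' \<noteq> j'\<close> by simp
  next
    case False
    then have "P i' * y * Q j \<in> D"
      using left[OF mem \<open>i \<noteq> j\<close>] by simp
    then show ?thesis
      using right False \<open>i' \<noteq> j'\<close> by blast
  qed
qed

text \<open>Conjugating the block at \<open>(i, j)\<close> by the elementary matrix 1 + e_ji gives,
  on the indices \<open>i\<close> and \<open>j\<close>, the rows (-y, y) and (-y, y). Its
  off-diagonal part is removed by two off-diagonal blocks, and the diagonal part remains with
  changed sign: three summands in all.\<close>

lemma diagonal_difference_mem:
  assumes fam: "dual_family P Q" and "i \<noteq> j"
    and mem: "\<And>k l. k \<noteq> l \<Longrightarrow> P k * y * Q l \<in> D"
  shows "P i * y * Q i - P j * y * Q j \<in> sums_of 3 D"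
proof -
  note qp = dual_family_simps[OF fam]
  define s s' where "s = 1 + P j * Q i" and "s' = 1 - P j * Q i"
  have "s * s' = 1" "s' * s = 1"
    using \<open>i \<noteq> j\<close> by (simp_all add: s_def s'_def algebra_simps qp)
  from conjugate_mem[OF this] have "s * (P i * y * Q j) * s' \<in> D"
    using mem \<open>i \<noteq> j\<close> by blast
  then have "P i * y * Q j - P j * y * Q i - s * (P i * y * Q j) * s' \<in> sums_of (1 + 1 + 1) D"
    using mem \<open>i \<noteq> j\<close> by (intro sums_of_diff sums_of_1) auto
  also have "P i * y * Q j - P j * y * Q i - s * (P i * y * Q j) * s' = P i * y * Q i - P j * y * Q j"
    using \<open>i \<noteq> j\<close> by (simp add: s_def s'_def algebra_simps qp)
  finally show ?thesis
    by (simp add: numeral_3_eq_3)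
qed

end

section \<open>Cuntz pairs and the decomposition of an arbitrary element\<close>

locale cuntz_pair =
  fixes U V :: "bool \<Rightarrow> 'a::complex_algebra"
  assumes dual: "dual_family U V"
    and complete: "U False * V False + U True * V True = 1"
begin

lemmas VU = dual_family_simps[OF dual]

text \<open>Splitting off the \<open>False\<close> half again and again gives infinitely many
  orthogonal blocks. An infinite family serves every polynomial, whatever the length of its shortest
  nonempty word.\<close>

definition seqU :: "nat \<Rightarrow> 'a" where "seqU n = U True ^ n * U False"
definition seqV :: "nat \<Rightarrow> 'a" where "seqV n = V False * V True ^ n"

text \<open>\<open>V True\<close> strips one factor \<open>U True\<close> from
  \<open>seqU (Suc k)\<close> and annihilates \<open>seqU 0\<close>, so both indices descend
  together until one of them is 0.\<close>

lemma dual_family_seq: "dual_family seqU seqV"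
proof -
  have "seqV i * seqU j = (if i = j then 1 else 0)" for i j
  proof (induction i arbitrary: j)
    case 0
    then show ?case
      by (cases j) (simp_all add: seqU_def seqV_def VU mult.assoc)
  next
    case (Suc i)
    have "seqV (Suc i) * seqU j = seqV i * (V True * seqU j)"
      by (simp add: seqV_def mult.assoc power_Suc2 del: power_Suc)
    also have "V True * seqU j = (case j of 0 \<Rightarrow> 0 | Suc k \<Rightarrow> seqU k)"
      by (cases j) (simp_all add: seqU_def VU mult.assoc)
    finally show ?case
      using Suc.IH by (cases j) simp_all
  qed
  then show ?thesis
    by (simp add: dual_family_def)
qed

lemma sums_of_similarity_invariant:
  assumes "similarity_invariant D" and "m > 0"
    and corner: "\<And>y. seqU 0 * y * seqV m \<in> D"
    and amplify: "\<And>y. \<exists>z. z = U False * y * V False + U True * z * V True"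
  shows "T \<in> sums_of 96 D"
proof -
  interpret similarity_invariant D by fact
  \<comment> \<open>With 0 for \<open>False\<close> and 1 for \<open>True\<close>, the families
    follow prefix codes: \<open>P\<close> has 0, 10, 11; \<open>R\<close> has 00, 01, 10, 11;
    \<open>seqU\<close> has 0, 10, 110 and so on. In \<open>Q\<close> and \<open>S\<close> the
    factors stand in reverse order.\<close>
  define P :: "bool option \<Rightarrow> 'a" where
    "P = case_option (U False) (\<lambda>b. U True * U b)"
  define Q :: "bool option \<Rightarrow> 'a" where
    "Q = case_option (V False) (\<lambda>b. V b * V True)"
  define R :: "bool \<times> bool \<Rightarrow> 'a" where "R = (\<lambda>(b, c). U b * U c)"
  define S :: "bool \<times> bool \<Rightarrow> 'a" where "S = (\<lambda>(b, c). V c * V b)"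
  have PQ: "dual_family P Q"
    by (auto simp: dual_family_def P_def Q_def VU mult.assoc split: option.split)
  have RS: "dual_family R S"
    by (auto simp: dual_family_def R_def S_def VU mult.assoc)
  \<comment> \<open>Membership passes between the families through shared blocks: (0, 10) is common
    to \<open>seqU\<close> and \<open>P\<close>, and (10, 11) is common to \<open>P\<close> and
    \<open>R\<close>.\<close>
  have "seqU 0 * y * seqV 1 \<in> D" for y
    by (rule off_diagonal_mem[OF dual_family_seq _ corner]) (use \<open>m > 0\<close> in simp_all)
  then have "P None * y * Q (Some False) \<in> D" for y
    by (simp add: P_def Q_def seqU_def seqV_def)
  then have PQ_mem: "P i * y * Q j \<in> D" if "i \<noteq> j" for i j y
    using that by (rule off_diagonal_mem[OF PQ, rotated]) simp
  have "R (True, False) * y * S (True, True) \<in> D" for y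
    using PQ_mem[of "Some False" "Some True" y] by (simp add: P_def Q_def R_def S_def)
  then have RS_mem: "R i * y * S j \<in> D" if "i \<noteq> j" for i j y
    using that by (rule off_diagonal_mem[OF RS, rotated]) simp
  have diag: "R i * y * S i \<in> sums_of 6 D" for i y
  proof -
    obtain z where z: "z = U False * y * V False + U True * z * V True"
      using amplify by blast
    \<comment> \<open>Both differences contain the block of \<open>z\<close> at 10, which cancels.
      The block of \<open>z\<close> at 0 minus that at 01 remains, and by the equation for
      \<open>z\<close> this is the block of \<open>y\<close> at 00.\<close>
    have "(P None * z * Q None - P (Some False) * z * Q (Some False))
        - (R (False, True) * z * S (False, True) - R (True, False) * z * S (True, False))
        \<in> sums_of (3 + 3) D"
      by (intro sums_of_diff diagonal_difference_mem[OF PQ] diagonal_difference_mem[OF RS]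
          PQ_mem RS_mem) simp_all
    also have "(P None * z * Q None - P (Some False) * z * Q (Some False))
        - (R (False, True) * z * S (False, True) - R (True, False) * z * S (True, False))
        = U False * (z - U True * z * V True) * V False"
      by (simp add: P_def Q_def R_def S_def algebra_simps)
    also have "z - U True * z * V True = U False * y * V False"
      using z by (metis add_diff_cancel_right')
    finally have *: "R (False, False) * y * S (False, False) \<in> sums_of 6 D"
      by (simp add: R_def S_def mult.assoc)
    show ?thesis
    proof (cases "i = (False, False)")
      case False
      then show ?thesis
        using similarity_invariant.transpose_mem[OF similarity_invariant_sums_of RS _ *, of "(False, False)" i]
        by simp
    qed (use * in simp)
  qed
  have entry: "R i * y * S j \<in> sums_of 6 D" for i j y
  proof (cases "i = j")
    case False
    \<comment> \<open>An off-diagonal entry is a single summand; padding with zeros gives all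
      sixteen entries the same count.\<close>
    from sums_of_mono[OF sums_of_1[OF RS_mem[OF this]] _ zero_mem] show ?thesis
      by simp
  qed (use diag in simp)
  have RS_complete: "(\<Sum>i\<in>UNIV. R i * S i) = 1"
  proof -
    have "(\<Sum>i\<in>UNIV. R i * S i) = (\<Sum>b\<in>UNIV. \<Sum>c\<in>UNIV. U b * (U c * V c) * V b)"
      by (simp add: sum.cartesian_product R_def S_def case_prod_unfold mult.assoc
          flip: UNIV_Times_UNIV)
    also have "\<dots> = (\<Sum>b\<in>UNIV. U b * (\<Sum>c\<in>UNIV. U c * V c) * V b)"
      by (simp only: sum_distrib_left sum_distrib_right)
    also have "\<dots> = 1"
      by (simp add: UNIV_bool complete)
    finally show ?thesis .
  qed
  have "T = (\<Sum>i\<in>UNIV. R i * S i) * T"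
    by (simp add: RS_complete)
  also have "\<dots> = (\<Sum>i\<in>UNIV. R i * S i * T)"
    by (rule sum_distrib_right)
  also have "\<dots> = (\<Sum>i\<in>UNIV. R i * S i * T * (\<Sum>j\<in>UNIV. R j * S j))"
    by (simp only: RS_complete mult_1_right)
  also have "\<dots> = (\<Sum>(i, j)\<in>UNIV \<times> UNIV. R i * (S i * T * R j) * S j)"
    by (simp only: sum_distrib_left mult.assoc sum.cartesian_product)
  also have "\<dots> \<in> sums_of (card ((UNIV :: (bool \<times> bool) set) \<times> (UNIV :: (bool \<times> bool) set)) * 6) D"
    by (intro sums_of_sum) (use entry in auto)
  finally show ?thesis
    by (simp add: card_cartesian_product card_prod)
qed

end

section \<open>Values of noncommutative polynomials\<close>

text \<open>\<open>a\<close> describes a path from vertex 0 to vertex \<open>length w\<close> whose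
  \<open>j\<close>-th edge carries the letter \<open>w ! j\<close>. Multiplying \<open>q i\<close>
  by the product follows \<open>v\<close> from vertex \<open>i\<close>, and the result survives only
  if \<open>v\<close> can be read there.\<close>

lemma prod_list_shift:
  fixes w :: "'x list"
  assumes fam: "dual_family p q"
  defines "a \<equiv> \<lambda>x. \<Sum>j | j < length w \<and> w ! j = x. p j * q (Suc j)"
  shows "q i * prod_list (map a v) = (if take (length v) (drop i w) = v then q (i + length v) else 0)"
proof (induction v arbitrary: i)
  case (Cons x v)
  have "q i * a x = (\<Sum>j | j < length w \<and> w ! j = x. if i = j then q (Suc j) else 0)"
    by (simp add: a_def sum_distrib_left dual_family_simps[OF fam])
  also have "\<dots> = (if i < length w \<and> w ! i = x then q (Suc i) else 0)"
    by (simp add: sum.delta)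
  finally have "q i * prod_list (map a (x # v))
      = (if i < length w \<and> w ! i = x then q (Suc i) * prod_list (map a v) else 0)"
    by (simp flip: mult.assoc)
  also have "\<dots> = (if take (length (x # v)) (drop i w) = x # v then q (i + length (x # v)) else 0)"
    unfolding Cons.IH by (cases "i < length w") (auto simp: Cons_nth_drop_Suc[symmetric])
  finally show ?case .
qed simp

text \<open>The path has only \<open>length w\<close> edges, so a word at least that long can be
  read along it only if it is \<open>w\<close> itself, starting at vertex 0.\<close>

lemma prod_list_shift_long:
  fixes w :: "'x list"
  assumes fam: "dual_family p q" and "w \<noteq> []" "length w \<le> length v"
  defines "a \<equiv> \<lambda>x. \<Sum>j | j < length w \<and> w ! j = x. p j * q (Suc j)"
  shows "prod_list (map a v) = (if v = w then p 0 * q (length w) else 0)"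
proof -
  obtain x v' where v: "v = x # v'"
    using assms(2,3) by (cases v) auto
  have "prod_list (map a v) = (\<Sum>j | j < length w \<and> w ! j = x. p j * (q (Suc j) * prod_list (map a v')))"
    by (simp add: v a_def sum_distrib_right mult.assoc)
  also have "\<dots> = (\<Sum>j | j < length w \<and> w ! j = x. if j = 0 \<and> v = w then p 0 * q (length w) else 0)"
  proof (intro sum.cong refl)
    fix j assume j: "j \<in> {j. j < length w \<and> w ! j = x}"
    \<comment> \<open>After the first letter, read at vertex \<open>j\<close>, at least
      \<open>length w - 1\<close> letters are left, but only \<open>length w - Suc j\<close> edges;
      this forces \<open>j = 0\<close>.\<close>
    have "take (length v') (drop (Suc j) w) = v' \<longleftrightarrow> j = 0 \<and> v = w"
    proof
      assume *: "take (length v') (drop (Suc j) w) = v'"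
      then have "length v' \<le> length w - Suc j"
        by (metis length_drop length_take min.cobounded1)
      then have "j = 0"
        using assms(3) j by (auto simp: v)
      moreover have "take (length v') (drop (Suc 0) w) = drop (Suc 0) w"
        using assms(3) by (simp add: v)
      ultimately show "j = 0 \<and> v = w"
        using * j assms(2) by (cases w) (auto simp: v)
    qed (auto simp: v)
    then show "p j * (q (Suc j) * prod_list (map a v'))
        = (if j = 0 \<and> v = w then p 0 * q (length w) else 0)"
      using prod_list_shift[OF fam, where w = w and i = "Suc j" and v = v'] by (auto simp: a_def v)
  qed
  also have "\<dots> = (if v = w then p 0 * q (length w) else 0)"
    using assms(2) by (auto simp: v sum.delta' intro!: sum.neutral)
  finally show ?thesis .
qed

lemma nceval_shift:
  fixes f :: ncpoly
  assumes fam: "dual_family p q" and "letters w \<noteq> []"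
    and min: "\<And>v. v \<in> Poly_Mapping.keys f \<Longrightarrow> letters v \<noteq> [] \<Longrightarrow> length (letters w) \<le> length (letters v)"
  defines "a \<equiv> \<lambda>x. \<Sum>j | j < length (letters w) \<and> letters w ! j = x. p j * q (Suc j)"
  shows "nceval a f = Poly_Mapping.lookup f 0 *\<^sub>C 1
    + Poly_Mapping.lookup f w *\<^sub>C (p 0 * q (length (letters w)))"
proof -
  \<comment> \<open>The empty word and \<open>w\<close> are added so that both terms occur in the
    sum even when their coefficients vanish.\<close>
  let ?W = "insert 0 (insert w (Poly_Mapping.keys f))"
  have "nceval a f = (\<Sum>v\<in>?W. Poly_Mapping.lookup f v *\<^sub>C prod_list (map a (letters v)))"
    by (rule nceval_superset) auto
  also have "\<dots> = (\<Sum>v\<in>?W. (if v = 0 then Poly_Mapping.lookup f 0 *\<^sub>C 1 else 0)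
      + (if v = w then Poly_Mapping.lookup f w *\<^sub>C (p 0 * q (length (letters w))) else 0))"
  proof (intro sum.cong refl)
    fix v assume "v \<in> ?W"
    show "Poly_Mapping.lookup f v *\<^sub>C prod_list (map a (letters v))
      = (if v = 0 then Poly_Mapping.lookup f 0 *\<^sub>C 1 else 0)
      + (if v = w then Poly_Mapping.lookup f w *\<^sub>C (p 0 * q (length (letters w))) else 0)"
    proof (cases "letters v = []")
      case True
      then have "v = 0" "v \<noteq> w"
        using assms(2) by (auto simp: zero_word_def word.expand)
      then show ?thesis
        by (simp add: zero_word_def)
    next
      case False
      then have "v \<noteq> 0" "length (letters w) \<le> length (letters v)"
        using \<open>v \<in> ?W\<close> min by (auto simp: zero_word_def)
      moreover from this(2) have "prod_list (map a (letters v))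
          = (if letters v = letters w then p 0 * q (length (letters w)) else 0)"
        unfolding a_def by (rule prod_list_shift_long[OF fam assms(2)])
      ultimately show ?thesis
        using word.expand[of v w] by auto
    qed
  qed
  also have "\<dots> = Poly_Mapping.lookup f 0 *\<^sub>C 1
      + Poly_Mapping.lookup f w *\<^sub>C (p 0 * q (length (letters w)))"
    by (simp add: sum.distrib)
  finally show ?thesis .
qed

lemma nceval_conjugate:
  assumes "s' * s = (1 :: 'a::complex_algebra)" "s * s' = 1"
  shows "nceval (\<lambda>i. s * a i * s') f = s * nceval a f * s'"
proof -
  have "prod_list (map (\<lambda>i. s * a i * s') v) = s * prod_list (map a v) * s'" for v
  proof (induction v)
    case (Cons x v)
    have "prod_list (map (\<lambda>i. s * a i * s') (x # v)) = s * a x * (s' * s) * prod_list (map a v) * s'"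
      using Cons.IH by (simp add: mult.assoc)
    then show ?case
      by (simp add: assms(1) mult.assoc)
  qed (simp add: assms)
  then show ?thesis
    by (simp add: nceval_def sum_distrib_left sum_distrib_right mult_scaleC_left mult_scaleC_right)
qed

section \<open>Differences of values of a polynomial\<close>

definition image_differences :: "ncpoly \<Rightarrow> 'a::complex_algebra set"
  where "image_differences f = {t - t' |t t'. t \<in> ncimage f \<and> t' \<in> ncimage f}"

lemma ncimage_conjugate:
  "s' * s = 1 \<Longrightarrow> s * s' = 1 \<Longrightarrow> t \<in> ncimage f \<Longrightarrow> s * t * s' \<in> ncimage f"
  unfolding ncimage_def by (auto simp flip: nceval_conjugate)

lemma similarity_invariant_image_differences: "similarity_invariant (image_differences f)"
proof
  have "nceval (\<lambda>_. 0) f \<in> ncimage f"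
    by (auto simp: ncimage_def)
  then show "0 \<in> image_differences f"
    unfolding image_differences_def using diff_self by (metis (mono_tags, lifting) mem_Collect_eq)
next
  fix x :: 'a assume "x \<in> image_differences f"
  then show "- x \<in> image_differences f"
    unfolding image_differences_def by (smt (verit) mem_Collect_eq minus_diff_eq)
next
  fix s s' x :: 'a assume s: "s * s' = 1" "s' * s = 1" and "x \<in> image_differences f"
  then obtain t t' where "x = t - t'" "t \<in> ncimage f" "t' \<in> ncimage f"
    by (auto simp: image_differences_def)
  moreover have "s * (t - t') * s' = s * t * s' - s * t' * s'"
    by (simp add: algebra_simps)
  ultimately show "s * x * s' \<in> image_differences f"
    unfolding image_differences_def using ncimage_conjugate[OF s(2,1)] by blast
qed

lemma nonconstant_minimal_word:
  assumes "nonconstant f"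
  obtains w where "w \<in> Poly_Mapping.keys f" "letters w \<noteq> []"
    "\<And>v. v \<in> Poly_Mapping.keys f \<Longrightarrow> letters v \<noteq> [] \<Longrightarrow> length (letters w) \<le> length (letters v)"
proof -
  have "\<exists>w. w \<in> Poly_Mapping.keys f \<and> letters w \<noteq> []"
  proof (rule ccontr)
    assume "\<nexists>w. w \<in> Poly_Mapping.keys f \<and> letters w \<noteq> []"
    then have "Poly_Mapping.lookup f v = 0" if "v \<noteq> 0" for v
      using that by (metis in_keys_iff word.exhaust_sel zero_word_def)
    then have "f = ncconst (Poly_Mapping.lookup f 0)"
      by (intro poly_mapping_eqI) (auto simp: ncconst_def lookup_single when_def)
    then show False
      using assms by (auto simp: nonconstant_def)
  qed
  then obtain w where "w \<in> Poly_Mapping.keys f \<and> letters w \<noteq> []"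
    "\<forall>v. v \<in> Poly_Mapping.keys f \<and> letters v \<noteq> [] \<longrightarrow> length (letters w) \<le> length (letters v)"
    using ex_has_least_nat[where m = "\<lambda>w. length (letters w)"
        and P = "\<lambda>w. w \<in> Poly_Mapping.keys f \<and> letters w \<noteq> []"] by blast
  then show thesis
    using that by blast
qed

text \<open>The value c + \<mu> e_0d is compared with its conjugate by a unipotent element supported
  at position (d, d+1). The scalar part cancels, and the entry at (0, d) produces an arbitrary entry
  at (0, d+1).\<close>

lemma corner_mem_image_differences:
  fixes p q :: "nat \<Rightarrow> 'a::complex_algebra"
  assumes fam: "dual_family p q" and "nonconstant f"
  obtains m where "m > 0" "\<And>y. p 0 * y * q m \<in> image_differences f"
proof -
  obtain w where w: "w \<in> Poly_Mapping.keys f" "letters w \<noteq> []"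
    "\<And>v. v \<in> Poly_Mapping.keys f \<Longrightarrow> letters v \<noteq> [] \<Longrightarrow> length (letters w) \<le> length (letters v)"
    by (rule nonconstant_minimal_word[OF assms(2)]) blast
  note qp = dual_family_simps[OF fam]
  define d c \<mu> where "d = length (letters w)" and "c = Poly_Mapping.lookup f 0"
    and "\<mu> = Poly_Mapping.lookup f w"
  have "d > 0" "\<mu> \<noteq> 0"
    using w by (simp_all add: d_def \<mu>_def in_keys_iff)
  have "nceval (\<lambda>x. \<Sum>j | j < length (letters w) \<and> letters w ! j = x. p j * q (Suc j)) f
      = c *\<^sub>C 1 + \<mu> *\<^sub>C (p 0 * q d)"
    unfolding d_def c_def \<mu>_def by (rule nceval_shift[OF fam w(2)]) (rule w(3))
  from this[symmetric] have t: "c *\<^sub>C 1 + \<mu> *\<^sub>C (p 0 * q d) \<in> ncimage f"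
    unfolding ncimage_def by blast
  have "p 0 * y * q (Suc d) \<in> image_differences f" for y
  proof -
    \<comment> \<open>The factor \<open>inverse \<mu>\<close> compensates the coefficient of the
      shortest word.\<close>
    define z where "z = inverse \<mu> *\<^sub>C y"
    define s s' where "s = 1 + p d * z * q (Suc d)" and "s' = 1 - p d * z * q (Suc d)"
    have s: "s' * s = 1" "s * s' = 1"
      by (simp_all add: s_def s'_def algebra_simps qp)
    have "p 0 * y * q (Suc d) = \<mu> *\<^sub>C (p 0 * z * q (Suc d))"
      using \<open>\<mu> \<noteq> 0\<close> by (simp add: z_def mult_scaleC_left mult_scaleC_right scaleC_scaleC scaleC_one)
    also have "p 0 * z * q (Suc d) = p 0 * q d - s * (p 0 * q d) * s'"
      using \<open>d > 0\<close> by (simp add: s_def s'_def algebra_simps qp)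
    also have "\<mu> *\<^sub>C \<dots> = (c *\<^sub>C 1 + \<mu> *\<^sub>C (p 0 * q d)) - s * (c *\<^sub>C 1 + \<mu> *\<^sub>C (p 0 * q d)) * s'"
      by (simp add: distrib_left distrib_right mult_scaleC_left mult_scaleC_right s
          complex_vector.scale_right_diff_distrib)
    also have "\<dots> \<in> image_differences f"
      unfolding image_differences_def using t ncimage_conjugate[OF s t] by blast
    finally show ?thesis .
  qed
  then show thesis
    using that[of "Suc d"] by simp
qed

section \<open>Orthonormal bases\<close>

lemma cinner_add_right: "cinner x (y + z) = cinner x y + cinner x (z :: 'a::complex_inner)"
  by (metis cinner_commute cinner_add_left complex_cnj_add)

lemma cinner_scaleC_right: "cinner x (c *\<^sub>C y) = cnj c * cinner x (y :: 'a::complex_inner)"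
  by (metis cinner_commute cinner_scaleC_left complex_cnj_mult)

lemma cinner_zero_left [simp]: "cinner 0 (x :: 'a::complex_inner) = 0"
  using cinner_add_left[of 0 0 x] by simp

lemma cinner_zero_right [simp]: "cinner (x :: 'a::complex_inner) 0 = 0"
  using cinner_add_right[of x 0 0] by simp

lemma cinner_diff_left: "cinner (x - y) z = cinner x z - cinner y (z :: 'a::complex_inner)"
  using cinner_add_left[of "x - y" y z] by simp

lemma cinner_diff_right: "cinner x (y - z) = cinner x y - cinner x (z :: 'a::complex_inner)"
  using cinner_add_right[of x "y - z" z] by simp

lemma cinner_sum_left: "cinner (\<Sum>b\<in>F. g b) (z :: 'a::complex_inner) = (\<Sum>b\<in>F. cinner (g b) z)"
  by (induction F rule: infinite_finite_induct) (simp_all add: cinner_add_left)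

lemma cinner_sum_right: "cinner (z :: 'a::complex_inner) (\<Sum>b\<in>F. g b) = (\<Sum>b\<in>F. cinner z (g b))"
  by (induction F rule: infinite_finite_induct) (simp_all add: cinner_add_right)

lemma cinner_self: "cinner x x = of_real ((norm (x :: 'a::complex_inner))\<^sup>2)"
proof -
  have "cnj (cinner x x) = cinner x x"
    by (metis cinner_commute)
  then have "Im (cinner x x) = 0"
    by (simp add: complex_eq_iff)
  then show ?thesis
    by (simp add: complex_eq_iff norm_eq_sqrt_cinner cinner_ge_zero)
qed

lemma norm_sq_cinner: "(norm (x :: 'a::complex_inner))\<^sup>2 = Re (cinner x x)"
  by (simp add: cinner_self)

section \<open>Orthonormal families and Bessel's inequality\<close>

definition orthonormal_family :: "('i \<Rightarrow> 'a::complex_inner) \<Rightarrow> 'i set \<Rightarrow> bool"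
  where "orthonormal_family \<phi> I \<longleftrightarrow>
    (\<forall>i\<in>I. \<forall>j\<in>I. cinner (\<phi> i) (\<phi> j) = (if i = j then 1 else 0))"

lemma norm_sq_orthonormal_sum:
  assumes "orthonormal_family \<phi> I" "finite F" "F \<subseteq> I"
  shows "(norm (\<Sum>i\<in>F. c i *\<^sub>C \<phi> i))\<^sup>2 = (\<Sum>i\<in>F. (cmod (c i))\<^sup>2)"
proof -
  have "cinner (\<Sum>i\<in>F. c i *\<^sub>C \<phi> i) (\<Sum>i\<in>F. c i *\<^sub>C \<phi> i)
      = (\<Sum>i\<in>F. \<Sum>j\<in>F. c i * cnj (c j) * cinner (\<phi> i) (\<phi> j))"
    unfolding cinner_sum_left
    by (simp add: cinner_sum_right cinner_scaleC_left cinner_scaleC_right sum_distrib_left mult_ac)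
  also have "\<dots> = (\<Sum>i\<in>F. \<Sum>j\<in>F. if i = j then c i * cnj (c j) else 0)"
  proof (intro sum.cong refl)
    fix i j assume "i \<in> F" "j \<in> F"
    then have "cinner (\<phi> i) (\<phi> j) = (if i = j then 1 else 0)"
      using assms unfolding orthonormal_family_def by blast
    then show "c i * cnj (c j) * cinner (\<phi> i) (\<phi> j) = (if i = j then c i * cnj (c j) else 0)"
      by simp
  qed
  also have "\<dots> = (\<Sum>i\<in>F. of_real ((cmod (c i))\<^sup>2))"
    using assms(2) by (simp add: complex_norm_square[symmetric])
  finally show ?thesis
    by (simp add: norm_sq_cinner)
qed

lemma bessel_identity:
  assumes "orthonormal_family \<phi> I" "finite F" "F \<subseteq> I"
  shows "(norm (x - (\<Sum>i\<in>F. cinner x (\<phi> i) *\<^sub>C \<phi> i)))\<^sup>2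
    = (norm x)\<^sup>2 - (\<Sum>i\<in>F. (cmod (cinner x (\<phi> i)))\<^sup>2)"
proof -
  define s where "s = (\<Sum>i\<in>F. cinner x (\<phi> i) *\<^sub>C \<phi> i)"
  have s: "cinner x s = of_real (\<Sum>i\<in>F. (cmod (cinner x (\<phi> i)))\<^sup>2)"
    by (simp add: s_def cinner_sum_right cinner_scaleC_right mult.commute
        flip: complex_norm_square of_real_power)
  then have "cinner s x = of_real (\<Sum>i\<in>F. (cmod (cinner x (\<phi> i)))\<^sup>2)"
    by (metis cinner_commute complex_cnj_complex_of_real)
  moreover have "cinner s s = of_real (\<Sum>i\<in>F. (cmod (cinner x (\<phi> i)))\<^sup>2)"
    unfolding cinner_self using norm_sq_orthonormal_sum[OF assms] by (simp add: s_def)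
  ultimately show ?thesis
    using s by (simp add: norm_sq_cinner cinner_diff_left cinner_diff_right flip: s_def)
qed

lemma bessel_inequality:
  assumes "orthonormal_family \<phi> I" "finite F" "F \<subseteq> I"
  shows "(\<Sum>i\<in>F. (cmod (cinner x (\<phi> i)))\<^sup>2) \<le> (norm x)\<^sup>2"
proof -
  have "0 \<le> (norm x)\<^sup>2 - (\<Sum>i\<in>F. (cmod (cinner x (\<phi> i)))\<^sup>2)"
    unfolding bessel_identity[OF assms, symmetric] by (rule zero_le_power2)
  then show ?thesis
    by linarith
qed

text \<open>Bessel's inequality for the family consisting of the single normalized vector
  \<open>y\<close>.\<close>

lemma cauchy_schwarz: "cmod (cinner x y) \<le> norm x * norm (y :: 'a::complex_inner)"
proof (cases "y = 0")
  case False
  define u where "u = complex_of_real (inverse (norm y)) *\<^sub>C y"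
  have "cinner u u = 1"
    unfolding u_def cinner_scaleC_left cinner_scaleC_right
    using False by (simp add: cinner_self[of y] power2_eq_square field_simps)
  then have "orthonormal_family (\<lambda>_. u) {()}"
    by (simp add: orthonormal_family_def)
  then have "(\<Sum>i\<in>{()}. (cmod (cinner x u))\<^sup>2) \<le> (norm x)\<^sup>2"
    by (rule bessel_inequality) simp_all
  then have "(cmod (cinner x u))\<^sup>2 \<le> (norm x)\<^sup>2"
    by simp
  then have "cmod (cinner x u) \<le> norm x"
    by (rule power2_le_imp_le) simp
  moreover have "cmod (cinner x u) = cmod (cinner x y) / norm y"
    by (simp add: u_def cinner_scaleC_right norm_mult norm_inverse divide_inverse mult.commute)
  ultimately show ?thesis
    using False by (simp add: pos_divide_le_eq)
qed simp

lemma bounded_linear_cinner_left: "bounded_linear (\<lambda>x. cinner x (y :: 'a::complex_inner))"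
  by (rule bounded_linear_intro[where K = "norm y"])
     (simp_all add: cinner_add_left scaleR_scaleC cinner_scaleC_left cauchy_schwarz
       scaleR_conv_of_real)

text \<open>The Cauchy criterion for the net of finite partial sums: two finite sets containing
  \<open>G\<close> both have sums within \<open>e / 2\<close> of \<open>sum f G\<close>.\<close>

lemma summable_on_small_tails:
  fixes f :: "'i \<Rightarrow> 'a::{real_normed_vector, complete_space}"
  assumes "\<And>e. e > 0 \<Longrightarrow> \<exists>G. finite G \<and> G \<subseteq> I \<and>
      (\<forall>F. finite F \<longrightarrow> F \<subseteq> I - G \<longrightarrow> norm (sum f F) < e)"
  shows "f summable_on I"
proof -
  have "\<exists>P. eventually P (finite_subsets_at_top I) \<and>
      (\<forall>F F'. P F \<and> P F' \<longrightarrow> dist (sum f F) (sum f F') < e)" if "e > 0" for e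
  proof -
    have "e / 2 > 0"
      using that by simp
    from assms[OF this] obtain G where G: "finite G" "G \<subseteq> I"
        "\<And>F. finite F \<Longrightarrow> F \<subseteq> I - G \<Longrightarrow> norm (sum f F) < e / 2"
      by blast
    have *: "dist (sum f F) (sum f G) < e / 2" if "finite F" "F \<subseteq> I" "G \<subseteq> F" for F
      using G(3)[of "F - G"] that sum_diff[of F G f] by (auto simp: dist_norm)
    show ?thesis
    proof (intro exI[where x = "\<lambda>F. finite F \<and> F \<subseteq> I \<and> G \<subseteq> F"] conjI allI impI)
      show "eventually (\<lambda>F. finite F \<and> F \<subseteq> I \<and> G \<subseteq> F) (finite_subsets_at_top I)"
        using G(1,2) by (auto simp: eventually_finite_subsets_at_top)
    next
      fix F F' assume "(finite F \<and> F \<subseteq> I \<and> G \<subseteq> F) \<and> (finite F' \<and> F' \<subseteq> I \<and> G \<subseteq> F')"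
      then have "dist (sum f F) (sum f G) < e / 2" "dist (sum f F') (sum f G) < e / 2"
        using * by blast+
      then show "dist (sum f F) (sum f F') < e"
        using dist_triangle_half_l by blast
    qed
  qed
  then have "cauchy_filter (filtermap (sum f) (finite_subsets_at_top I))"
    by (simp add: cauchy_filter_metric_filtermap)
  moreover have "complete (UNIV :: 'a set)"
    by (meson Cauchy_convergent UNIV_I complete_def convergent_def)
  ultimately obtain L where "(sum f \<longlongrightarrow> L) (finite_subsets_at_top I)"
    using complete_uniform[where S = "UNIV :: 'a set"]
    by (force simp add: filterlim_def)
  then show ?thesis
    by (auto simp: summable_on_def has_sum_def)
qed

text \<open>By Bessel the coefficients are square summable, and the squared norm of a finite sum
  over \<psi> is the sum of their squared moduli. Hence small tails of the scalar series give small
  tails here.\<close>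

lemma orthonormal_summable:
  fixes \<phi> :: "'i \<Rightarrow> 'a::complex_inner" and \<psi> :: "'i \<Rightarrow> 'b::chilbert_space"
  assumes \<phi>: "orthonormal_family \<phi> I" and \<psi>: "orthonormal_family \<psi> I"
  shows "(\<lambda>i. cinner x (\<phi> i) *\<^sub>C \<psi> i) summable_on I"
proof (rule summable_on_small_tails)
  fix e :: real assume "e > 0"
  define c where "c i = (cmod (cinner x (\<phi> i)))\<^sup>2" for i
  have "bdd_above (sum c ` {F. F \<subseteq> I \<and> finite F})"
    using bessel_inequality[OF \<phi>] unfolding c_def bdd_above_def by blast
  then have "c summable_on I"
    by (intro nonneg_bdd_above_summable_on) (simp_all add: c_def)
  then have "(c has_sum infsum c I) I"
    by simp
  moreover have "e\<^sup>2 / 2 > 0"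
    using \<open>e > 0\<close> by simp
  ultimately have "\<forall>\<^sub>F F in finite_subsets_at_top I. dist (sum c F) (infsum c I) < e\<^sup>2 / 2"
    unfolding has_sum_def tendsto_iff by blast
  then obtain G where G: "finite G" "G \<subseteq> I"
      "\<forall>F. finite F \<and> G \<subseteq> F \<and> F \<subseteq> I \<longrightarrow> dist (sum c F) (infsum c I) < e\<^sup>2 / 2"
    unfolding eventually_finite_subsets_at_top by (elim exE conjE) (rule that)
  show "\<exists>G. finite G \<and> G \<subseteq> I \<and> (\<forall>F. finite F \<longrightarrow> F \<subseteq> I - G \<longrightarrow>
      norm (\<Sum>i\<in>F. cinner x (\<phi> i) *\<^sub>C \<psi> i) < e)"
  proof (intro exI[of _ G] conjI G(1,2) allI impI)
    fix F assume F: "finite F" "F \<subseteq> I - G"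
    have "dist (sum c (G \<union> F)) (infsum c I) < e\<^sup>2 / 2" "dist (sum c G) (infsum c I) < e\<^sup>2 / 2"
      by (intro G(3)[rule_format]; use F G(1,2) in blast)+
    then have "dist (sum c (G \<union> F)) (sum c G) < e\<^sup>2"
      by (rule dist_triangle_half_l)
    moreover have "sum c (G \<union> F) = sum c G + sum c F"
      using F G(1) by (intro sum.union_disjoint) auto
    ultimately have "sum c F < e\<^sup>2"
      by (simp add: dist_real_def)
    then have "(norm (\<Sum>i\<in>F. cinner x (\<phi> i) *\<^sub>C \<psi> i))\<^sup>2 < e\<^sup>2"
      using norm_sq_orthonormal_sum[OF \<psi> F(1)] F(2) by (simp add: c_def subset_iff)
    then show "norm (\<Sum>i\<in>F. cinner x (\<phi> i) *\<^sub>C \<psi> i) < e"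
      using \<open>e > 0\<close> power2_less_imp_less by force
  qed
qed

section \<open>Partial isometries carrying one orthonormal family to another\<close>

definition transfer_map :: "('i \<Rightarrow> 'a) \<Rightarrow> ('i \<Rightarrow> 'b) \<Rightarrow> 'i set \<Rightarrow> 'a::chilbert_space \<Rightarrow> 'b::chilbert_space"
  where "transfer_map \<phi> \<psi> I x = (\<Sum>\<^sub>\<infinity>i\<in>I. cinner x (\<phi> i) *\<^sub>C \<psi> i)"

context
  fixes \<phi> :: "'i \<Rightarrow> 'a::chilbert_space" and \<psi> :: "'i \<Rightarrow> 'b::chilbert_space" and I
  assumes \<phi>: "orthonormal_family \<phi> I" and \<psi>: "orthonormal_family \<psi> I"
begin

lemma transfer_map_has_sum:
  "((\<lambda>i. cinner x (\<phi> i) *\<^sub>C \<psi> i) has_sum transfer_map \<phi> \<psi> I x) I"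
  unfolding transfer_map_def by (rule has_sum_infsum[OF orthonormal_summable[OF \<phi> \<psi>]])

lemma norm_transfer_map_le: "norm (transfer_map \<phi> \<psi> I x) \<le> norm x"
proof (rule tendsto_upperbound)
  show "((\<lambda>F. norm (\<Sum>i\<in>F. cinner x (\<phi> i) *\<^sub>C \<psi> i)) \<longlongrightarrow> norm (transfer_map \<phi> \<psi> I x))
      (finite_subsets_at_top I)"
    using transfer_map_has_sum[of x] unfolding has_sum_def by (rule tendsto_norm)
  show "\<forall>\<^sub>F F in finite_subsets_at_top I. norm (\<Sum>i\<in>F. cinner x (\<phi> i) *\<^sub>C \<psi> i) \<le> norm x"
  proof (rule eventually_finite_subsets_at_top_weakI)
    fix F assume F: "finite F" "F \<subseteq> I"
    have "(norm (\<Sum>i\<in>F. cinner x (\<phi> i) *\<^sub>C \<psi> i))\<^sup>2 \<le> (norm x)\<^sup>2"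
      unfolding norm_sq_orthonormal_sum[OF \<psi> F] by (rule bessel_inequality[OF \<phi> F])
    then show "norm (\<Sum>i\<in>F. cinner x (\<phi> i) *\<^sub>C \<psi> i) \<le> norm x"
      by (rule power2_le_imp_le) simp
  qed
qed simp

lemma bounded_clinear_transfer_map: "bounded_clinear (transfer_map \<phi> \<psi> I)"
proof -
  have add: "transfer_map \<phi> \<psi> I (x + y) = transfer_map \<phi> \<psi> I x + transfer_map \<phi> \<psi> I y" for x y
    by (rule has_sum_unique[OF transfer_map_has_sum])
       (simp add: cinner_add_left scaleC_add_left has_sum_add transfer_map_has_sum)
  have scale: "transfer_map \<phi> \<psi> I (c *\<^sub>C x) = c *\<^sub>C transfer_map \<phi> \<psi> I x" for c x
    by (rule has_sum_unique[OF transfer_map_has_sum])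
       (simp add: cinner_scaleC_left flip: scaleC_scaleC,
        rule has_sum_bounded_linear[OF scaleC_as_bounded_linear transfer_map_has_sum])
  have "bounded_linear (transfer_map \<phi> \<psi> I)"
    by (rule bounded_linear_intro[where K = 1])
       (simp_all add: add scale scaleR_scaleC norm_transfer_map_le)
  then show ?thesis
    by (simp add: bounded_clinear_def scale)
qed

end

text \<open>Exchanging the two families gives the adjoint: both sides expand into the same scalar
  series.\<close>

lemma cinner_transfer_map:
  assumes "orthonormal_family \<phi> I" "orthonormal_family \<psi> I"
  shows "cinner (transfer_map \<phi> \<psi> I x) y = cinner x (transfer_map \<psi> \<phi> I y)"
proof (rule has_sum_unique)
  show "((\<lambda>i. cinner x (\<phi> i) * cinner (\<psi> i) y) has_sum cinner (transfer_map \<phi> \<psi> I x) y) I"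
    using has_sum_bounded_linear[OF bounded_linear_cinner_left transfer_map_has_sum[OF assms]]
    by (simp add: cinner_scaleC_left)
  \<comment> \<open>The inner product is linear in its first argument, so the second expansion is
    made with the arguments swapped and then conjugated.\<close>
  have "((\<lambda>i. cinner (cinner y (\<psi> i) *\<^sub>C \<phi> i) x) has_sum cinner (transfer_map \<psi> \<phi> I y) x) I"
    by (rule has_sum_bounded_linear[OF bounded_linear_cinner_left
          transfer_map_has_sum[OF assms(2,1)]])
  then have "((\<lambda>i. cnj (cinner (cinner y (\<psi> i) *\<^sub>C \<phi> i) x)) has_sum
      cnj (cinner (transfer_map \<psi> \<phi> I y) x)) I"
    by simp
  moreover have "cnj (cinner (cinner y (\<psi> i) *\<^sub>C \<phi> i) x) = cinner x (\<phi> i) * cinner (\<psi> i) y" for i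
    by (simp add: cinner_scaleC_left cinner_commute[of x] cinner_commute[of "\<psi> i"])
  ultimately show "((\<lambda>i. cinner x (\<phi> i) * cinner (\<psi> i) y) has_sum
      cinner x (transfer_map \<psi> \<phi> I y)) I"
    by (simp only: cinner_commute[of x "transfer_map \<psi> \<phi> I y"])
qed

lemma transfer_map_basis:
  assumes "orthonormal_family \<phi> I" "orthonormal_family \<psi> I" "i \<in> I"
  shows "transfer_map \<phi> \<psi> I (\<phi> i) = \<psi> i"
proof (rule has_sum_unique[OF transfer_map_has_sum[OF assms(1,2)]])
  show "((\<lambda>j. cinner (\<phi> i) (\<phi> j) *\<^sub>C \<psi> j) has_sum \<psi> i) I"
    using assms(1,3)
    by (intro has_sum_finite_neutralI[where B = "{i}"])
       (auto simp: orthonormal_family_def scaleC_one)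
qed

lemma transfer_map_orthogonal:
  assumes "\<And>i. i \<in> I \<Longrightarrow> cinner x (\<phi> i) = 0"
  shows "transfer_map \<phi> \<psi> I x = 0"
  using assms by (simp add: transfer_map_def infsum_0)

text \<open>With both families equal, \<open>transfer_map\<close> is the orthogonal projection onto
  the closed span; it is the identity exactly when the span is dense. The set serves as its own
  index set through \<open>id\<close>.\<close>

definition is_onb :: "'a::chilbert_space set \<Rightarrow> bool"
  where "is_onb B \<longleftrightarrow> orthonormal_family id B \<and> (\<forall>x. transfer_map id id B x = x)"

text \<open>A maximal orthonormal set exists by Zorn's lemma. If some \<open>x\<close> differed from
  its expansion, the normalized remainder would be orthogonal to the set and could be added to
  it.\<close>

lemma onb_exists: "\<exists>B :: 'a::chilbert_space set. is_onb B"
proof -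
  let ?O = "{B :: 'a set. orthonormal_family id B}"
  have "\<exists>M\<in>?O. \<forall>X\<in>?O. M \<subseteq> X \<longrightarrow> X = M"
  proof (rule subset_Zorn', clarify)
    fix C assume C: "subset.chain ?O C"
    show "orthonormal_family id (\<Union>C)"
      unfolding orthonormal_family_def
    proof (intro ballI)
      fix x y assume "x \<in> \<Union>C" "y \<in> \<Union>C"
      then obtain X where "X \<in> C" "x \<in> X" "y \<in> X"
        using C unfolding subset_chain_def by (meson UnionE subsetD)
      moreover have "orthonormal_family id X"
        using C \<open>X \<in> C\<close> unfolding subset_chain_def by blast
      ultimately show "cinner (id x) (id y) = (if x = y then 1 else 0)"
        unfolding orthonormal_family_def by blast
    qed
  qed
  then obtain B :: "'a set" where B: "orthonormal_family id B"
      "\<And>X. orthonormal_family id X \<Longrightarrow> B \<subseteq> X \<Longrightarrow> X = B"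
    by auto
  have "transfer_map id id B x = x" for x
  proof (rule ccontr)
    define d where "d = x - transfer_map id id B x"
    assume "transfer_map id id B x \<noteq> x"
    then have d: "norm d \<noteq> 0"
      by (simp add: d_def)
    have ortho: "cinner d b = 0" if "b \<in> B" for b
      using that transfer_map_basis[OF B(1) B(1) that]
      by (simp add: d_def cinner_diff_left cinner_transfer_map[OF B(1) B(1)])
    define u where "u = complex_of_real (inverse (norm d)) *\<^sub>C d"
    have u: "cinner u u = 1"
      unfolding u_def cinner_scaleC_left cinner_scaleC_right
      using d by (simp add: cinner_self[of d] power2_eq_square field_simps)
    have ub: "cinner u b = 0" if "b \<in> B" for b
      using ortho[OF that] by (simp add: u_def cinner_scaleC_left)
    then have bu: "cinner b u = 0" if "b \<in> B" for b
      using that cinner_commute[of b u] by simp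
    have "orthonormal_family id (insert u B)"
      using B(1) u ub bu unfolding orthonormal_family_def by auto
    then have "u \<in> B"
      using B(2)[of "insert u B"] by auto
    then show False
      using u ub by force
  qed
  with B(1) show ?thesis
    unfolding is_onb_def by blast
qed

lemma infinite_onb:
  fixes B :: "'a::chilbert_space set"
  assumes "is_onb B" "\<not> cfinite_dim (UNIV :: 'a set)"
  shows "infinite B"
proof
  assume "finite B"
  have "x \<in> cspan B" for x
  proof -
    have "x = (\<Sum>b\<in>B. cinner x b *\<^sub>C b)"
      using assms(1) \<open>finite B\<close> unfolding is_onb_def transfer_map_def by simp
    also have "\<dots> \<in> cspan B"
      by (intro complex_vector.span_sum complex_vector.span_scale complex_vector.span_base)
    finally show ?thesis .
  qed
  then show False
    using assms(2) \<open>finite B\<close> unfolding cfinite_dim_def by blast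
qed

section \<open>Operators on an infinite-dimensional Hilbert space\<close>

text \<open>Moving the inner map across the inner product as its adjoint turns the coefficient at
  \<open>\<psi> i\<close> into the one at \<open>\<phi> i\<close>.\<close>

lemma transfer_map_compose:
  assumes \<phi>: "orthonormal_family \<phi> I" and \<psi>: "orthonormal_family \<psi> I"
  shows "transfer_map \<psi> \<eta> I (transfer_map \<phi> \<psi> I x) = transfer_map \<phi> \<eta> I x"
  unfolding transfer_map_def[of \<psi> \<eta>] transfer_map_def[of \<phi> \<eta>]
  by (intro infsum_cong) (simp add: cinner_transfer_map[OF \<phi> \<psi>] transfer_map_basis[OF \<psi> \<phi>])

lemma transfer_map_compose_orthogonal:
  assumes \<phi>: "orthonormal_family \<phi> I" and \<psi>: "orthonormal_family \<psi> I"
    and "\<And>i j. i \<in> I \<Longrightarrow> j \<in> I \<Longrightarrow> cinner (\<psi>' i) (\<psi> j) = 0"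
  shows "transfer_map \<psi>' \<eta> I (transfer_map \<phi> \<psi> I x) = 0"
proof (rule transfer_map_orthogonal)
  fix i assume "i \<in> I"
  then have "transfer_map \<psi> \<phi> I (\<psi>' i) = 0"
    using assms(3) by (intro transfer_map_orthogonal) blast
  then show "cinner (transfer_map \<phi> \<psi> I x) (\<psi>' i) = 0"
    by (simp add: cinner_transfer_map[OF \<phi> \<psi>])
qed

lemma orthonormal_family_reindex:
  assumes "orthonormal_family \<phi> J" "inj_on s I" "s ` I \<subseteq> J"
  shows "orthonormal_family (\<phi> \<circ> s) I"
  using assms unfolding orthonormal_family_def by (auto simp: inj_on_eq_iff image_subset_iff)

lemma apply_transfer_op:
  assumes "orthonormal_family \<phi> I" "orthonormal_family \<psi> I"
  shows "apply_op (Abs_op (transfer_map \<phi> \<psi> I)) = transfer_map \<phi> \<psi> I"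
  using Abs_op_inverse bounded_clinear_transfer_map[OF assms] by blast

text \<open>An infinite orthonormal basis splits into two halves, each in bijection with the whole
  basis; the isometries map the basis onto these halves. The adjoint relations are recorded because
  the amplification relies on orthogonality of the two ranges.\<close>

lemma cuntz_isometries_exist:
  assumes "\<not> cfinite_dim (UNIV :: 'h::chilbert_space set)"
  obtains U1 U2 V1 V2 :: "'h::chilbert_space bounded_op"
  where "V1 * U1 = 1" "V2 * U2 = 1" "V1 * U2 = 0" "V2 * U1 = 0" "U1 * V1 + U2 * V2 = 1"
    "\<And>x y. cinner (apply_op U1 x) y = cinner x (apply_op V1 y)"
    "\<And>x y. cinner (apply_op U2 x) y = cinner x (apply_op V2 y)"
proof -
  obtain B :: "'h set" where B: "is_onb B"
    using onb_exists by blast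
  then have on: "orthonormal_family id B" and complete: "transfer_map id id B x = x" for x
    by (auto simp: is_onb_def)
  \<comment> \<open>Two disjoint copies of an infinite set are equinumerous with the set.\<close>
  obtain h where h: "bij_betw h (B <+> B) B"
    using card_of_Plus_infinite1[OF infinite_onb[OF B assms] card_of_mono1[OF subset_refl]]
      card_of_ordIso by blast
  define s1 s2 where "s1 = h \<circ> Inl" and "s2 = h \<circ> Inr"
  have inj: "inj_on s1 B" "inj_on s2 B"
    using bij_betw_imp_inj_on[OF h] by (auto simp: s1_def s2_def inj_on_def)
  have h_image: "h ` (B <+> B) = s1 ` B \<union> s2 ` B"
    unfolding s1_def s2_def Plus_def by (simp add: image_Un image_comp)
  then have cover: "s1 ` B \<union> s2 ` B = B"
    using bij_betw_imp_surj_on[OF h] by simp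
  have disj: "s1 ` B \<inter> s2 ` B = {}"
    using bij_betw_imp_inj_on[OF h] by (auto simp: s1_def s2_def inj_on_def)
  have on1: "orthonormal_family s1 B" and on2: "orthonormal_family s2 B"
    using orthonormal_family_reindex[OF on inj(1)] orthonormal_family_reindex[OF on inj(2)] cover
    by auto
  have ortho: "cinner (s1 i) (s2 j) = 0" "cinner (s2 j) (s1 i) = 0" if "i \<in> B" "j \<in> B" for i j
    using on that cover disj unfolding orthonormal_family_def
    by (metis IntI UnI1 UnI2 empty_iff id_apply imageI)+
  note ops = apply_transfer_op[OF on on1] apply_transfer_op[OF on on2]
    apply_transfer_op[OF on1 on] apply_transfer_op[OF on2 on]
  show thesis
  \<comment> \<open>The witnesses are V1, U1, V2, U2 in this order: U1 sends a basis vector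
    \<open>b\<close> to \<open>s1 b\<close>, U2 sends it to \<open>s2 b\<close>, and V1, V2 are the
    adjoints.\<close>
  proof (rule that[of "Abs_op (transfer_map s1 id B)" "Abs_op (transfer_map id s1 B)"
        "Abs_op (transfer_map s2 id B)" "Abs_op (transfer_map id s2 B)"])
    have "transfer_map s1 s1 B x + transfer_map s2 s2 B x = x" for x
    proof -
      have part: "((\<lambda>b. cinner x b *\<^sub>C b) has_sum transfer_map s s B x) (s ` B)"
        if "orthonormal_family s B" "inj_on s B" for s
        using transfer_map_has_sum[OF that(1) that(1), of x]
        by (simp add: has_sum_reindex[OF that(2)] o_def)
      have "((\<lambda>b. cinner x b *\<^sub>C b) has_sum x) B"
        using transfer_map_has_sum[OF on on, of x] by (simp add: complete)
      moreover have "((\<lambda>b. cinner x b *\<^sub>C b) has_sum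
          transfer_map s1 s1 B x + transfer_map s2 s2 B x) B"
        using has_sum_Un_disjoint[OF part[OF on1 inj(1)] part[OF on2 inj(2)] disj]
        unfolding cover .
      ultimately show ?thesis
        by (metis has_sum_unique)
    qed
    then show "Abs_op (transfer_map id s1 B) * Abs_op (transfer_map s1 id B)
        + Abs_op (transfer_map id s2 B) * Abs_op (transfer_map s2 id B) = 1"
      by (simp add: apply_op_inject[symmetric] plus_bounded_op.rep_eq times_bounded_op.rep_eq
          one_bounded_op.rep_eq ops transfer_map_compose[OF on1 on] transfer_map_compose[OF on2 on])
  qed (simp_all add: apply_op_inject[symmetric] times_bounded_op.rep_eq one_bounded_op.rep_eq
      zero_bounded_op.rep_eq ops transfer_map_compose[OF on on1] transfer_map_compose[OF on on2]
      complete ortho transfer_map_compose_orthogonal[OF on on1] transfer_map_compose_orthogonal[OF on on2]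
      cinner_transfer_map[OF on on1] cinner_transfer_map[OF on on2])
qed

text \<open>
  The partial sums of \<open>\<Sum>n. U2^n * U1 * y * V1 * V2^n\<close> converge only pointwise: \<open>V2^n x\<close> need not
  tend to \<open>0\<close>, but \<open>\<parallel>V2^n x\<parallel>\<^sup>2\<close> decreases, and its decrements control the tails.
\<close>

lemma amplification_exists:
  fixes U1 U2 V1 V2 y :: "'h::chilbert_space bounded_op"
  assumes UV: "V1 * U1 = 1" "V2 * U2 = 1" "V1 * U2 = 0" "V2 * U1 = 0" "U1 * V1 + U2 * V2 = 1"
    and adj1: "\<And>x y. cinner (apply_op U1 x) y = cinner x (apply_op V1 y)"
    and adj2: "\<And>x y. cinner (apply_op U2 x) y = cinner x (apply_op V2 y)"
  obtains z where "z = U1 * y * V1 + U2 * z * V2"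
proof -
  have mult: "apply_op (S * T) x = apply_op S (apply_op T x)" for S T :: "'h bounded_op" and x
    by (simp add: times_bounded_op.rep_eq)
  have add: "apply_op (S + T) x = apply_op S x + apply_op T x" for S T :: "'h bounded_op" and x
    by (simp add: plus_bounded_op.rep_eq)
  have lin: "bounded_linear (apply_op S)" for S :: "'h bounded_op"
    using apply_op[of S] by (simp add: bounded_clinear_def)
  have scale: "apply_op S (c *\<^sub>C x) = c *\<^sub>C apply_op S x" for S :: "'h bounded_op" and c x
    using apply_op[of S] by (simp add: bounded_clinear_def)
  have cancel: "apply_op V1 (apply_op U1 x) = x" "apply_op V2 (apply_op U2 x) = x"
    "apply_op V1 (apply_op U2 x) = 0" for x
    by (simp_all add: UV one_bounded_op.rep_eq zero_bounded_op.rep_eq flip: mult)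
  have split: "x = apply_op U1 (apply_op V1 x) + apply_op U2 (apply_op V2 x)" for x
    by (simp add: UV(5) one_bounded_op.rep_eq flip: mult add)
  have pyth: "(norm (apply_op U1 v + apply_op U2 w))\<^sup>2 = (norm v)\<^sup>2 + (norm w)\<^sup>2" for v w
  proof -
    have "apply_op V2 (apply_op U1 v) = 0"
      by (simp add: UV zero_bounded_op.rep_eq flip: mult)
    then show ?thesis
      by (simp add: norm_sq_cinner cinner_add_left cinner_add_right adj1 adj2 cancel)
  qed
  have pyth': "(norm x)\<^sup>2 = (norm (apply_op V1 x))\<^sup>2 + (norm (apply_op V2 x))\<^sup>2" for x
    using pyth[of "apply_op V1 x" "apply_op V2 x"] split[of x] by simp
  have isom2: "norm (apply_op U2 w) = norm w" for w
    using pyth[of 0 w] linear_0[OF bounded_linear.linear[OF lin]] by simp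
  obtain K where K: "K \<ge> 0" "norm (apply_op y x) \<le> norm x * K" for x
    using bounded_linear.nonneg_bounded[OF lin] by blast
  \<comment> \<open>Iterating the desired equation from 0 makes \<open>S n\<close> the partial sum
    with \<open>n\<close> terms.\<close>
  define S where "S = rec_nat 0 (\<lambda>_ R. U1 * y * V1 + U2 * R * V2)"
  have S_0: "apply_op (S 0) x = 0" for x
    by (simp add: S_def zero_bounded_op.rep_eq)
  have S_Suc: "apply_op (S (Suc n)) x
      = apply_op U1 (apply_op y (apply_op V1 x)) + apply_op U2 (apply_op (S n) (apply_op V2 x))" for n x
    by (simp add: S_def mult add)
  define r where "r n x = (norm ((apply_op V2 ^^ n) x))\<^sup>2" for n x
  \<comment> \<open>The terms of \<open>S m\<close> have orthogonal ranges, and the squared norms of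
    \<open>V1 * V2^k\<close> applied to \<open>x\<close> telescope to the decrease of
    \<open>r\<close>.\<close>
  have step: "(norm (apply_op (S m) x))\<^sup>2 \<le> K\<^sup>2 * ((norm x)\<^sup>2 - r m x)" for m x
  proof (induction m arbitrary: x)
    case 0
    then show ?case by (simp add: S_0 r_def)
  next
    case (Suc m)
    have "(norm (apply_op y (apply_op V1 x)))\<^sup>2 \<le> K\<^sup>2 * (norm (apply_op V1 x))\<^sup>2"
      using power_mono[OF K(2)[of "apply_op V1 x"], of 2] by (simp add: power_mult_distrib mult.commute)
    then show ?case
      using Suc.IH[of "apply_op V2 x"] pyth'[of x]
      by (simp add: S_Suc pyth r_def funpow_swap1 algebra_simps)
  qed
  \<comment> \<open>The difference equals \<open>U2^n * S m * V2^n\<close>. Each induction step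
    strips one isometry \<open>U2\<close>, down to the estimate \<open>step\<close>.\<close>
  have tail: "(norm (apply_op (S (n + m)) x - apply_op (S n) x))\<^sup>2 \<le> K\<^sup>2 * (r n x - r (n + m) x)" for n m x
  proof (induction n arbitrary: x)
    case 0
    then show ?case using step[of m x] by (simp add: S_0 r_def)
  next
    case (Suc n)
    have "apply_op (S (Suc n + m)) x - apply_op (S (Suc n)) x
        = apply_op U2 (apply_op (S (n + m)) (apply_op V2 x) - apply_op (S n) (apply_op V2 x))"
      by (simp add: S_Suc linear_diff[OF bounded_linear.linear[OF lin]])
    then show ?case
      using Suc.IH[of "apply_op V2 x"] by (simp add: isom2 r_def funpow_swap1)
  qed
  have "convergent (\<lambda>n. apply_op (S n) x)" for x
  proof -
    have "decseq (\<lambda>n. r n x)"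
    proof (rule decseq_SucI)
      show "r (Suc n) x \<le> r n x" for n
        using pyth'[of "(apply_op V2 ^^ n) x"] by (simp add: r_def)
    qed
    moreover have "bdd_below (range (\<lambda>n. r n x))"
      by (rule bdd_belowI[of _ 0]) (auto simp: r_def)
    ultimately have "convergent (\<lambda>n. K\<^sup>2 * r n x)"
      by (intro convergent_mult convergent_const) (auto intro: LIMSEQ_decseq_INF convergentI)
    then have cauchy: "Cauchy (\<lambda>n. K\<^sup>2 * r n x)"
      by (rule convergent_Cauchy)
    show ?thesis
    proof (rule Cauchy_convergent, rule metric_CauchyI)
      fix e :: real assume "e > 0"
      then obtain N where N: "\<And>m n. m \<ge> N \<Longrightarrow> n \<ge> N \<Longrightarrow> dist (K\<^sup>2 * r m x) (K\<^sup>2 * r n x) < e\<^sup>2"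
        using metric_CauchyD[OF cauchy, of "e\<^sup>2"] by auto
      have *: "dist (apply_op (S m) x) (apply_op (S n) x) < e" if "N \<le> m" "m \<le> n" for m n
      proof -
        have "(norm (apply_op (S n) x - apply_op (S m) x))\<^sup>2 < e\<^sup>2"
          using tail[of m "n - m" x] N[of m n] that by (simp add: right_diff_distrib dist_real_def)
        then have "norm (apply_op (S n) x - apply_op (S m) x) < e"
          by (rule power2_less_imp_less) (use \<open>e > 0\<close> in simp)
        then show ?thesis
          by (simp add: dist_norm norm_minus_commute)
      qed
      show "\<exists>N. \<forall>m\<ge>N. \<forall>n\<ge>N. dist (apply_op (S m) x) (apply_op (S n) x) < e"
        by (intro exI[of _ N] allI impI) (metis * dist_commute linear)
    qed
  qed
  then have lim: "(\<lambda>n. apply_op (S n) x) \<longlonglongrightarrow> lim (\<lambda>n. apply_op (S n) x)" for x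
    by (simp add: convergent_LIMSEQ_iff)
  define Z where "Z x = lim (\<lambda>n. apply_op (S n) x)" for x
  note lim = lim[folded Z_def]
  have Z_add: "Z (x + x') = Z x + Z x'" for x x'
    using LIMSEQ_unique[OF lim[of "x + x'"]] tendsto_add[OF lim lim]
    by (simp add: linear_add[OF bounded_linear.linear[OF lin]])
  have Z_scale: "Z (c *\<^sub>C x) = c *\<^sub>C Z x" for c x
    using LIMSEQ_unique[OF lim[of "c *\<^sub>C x"]]
      bounded_linear.tendsto[OF scaleC_as_bounded_linear lim, of c x]
    by (simp add: scale)
  have "norm (Z x) \<le> norm x * K" for x
  proof (rule LIMSEQ_le_const2[OF tendsto_norm[OF lim]], intro exI allI impI)
    fix n
    have "K\<^sup>2 * ((norm x)\<^sup>2 - r n x) \<le> K\<^sup>2 * (norm x)\<^sup>2"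
      by (intro mult_left_mono) (simp_all add: r_def)
    then have "(norm (apply_op (S n) x))\<^sup>2 \<le> (norm x * K)\<^sup>2"
      using step[of n x] by (simp add: power_mult_distrib mult.commute)
    then show "norm (apply_op (S n) x) \<le> norm x * K"
      by (rule power2_le_imp_le) (use K(1) in simp)
  qed
  then have "bounded_clinear Z"
    unfolding bounded_clinear_def using Z_add Z_scale
    by (auto intro!: bounded_linear_intro[where K = K] simp: scaleR_scaleC)
  then have apply_Z: "apply_op (Abs_op Z) = Z"
    using Abs_op_inverse by blast
  \<comment> \<open>The recursion for \<open>S\<close> is passed to the pointwise limit.\<close>
  have fixpoint: "Z x = apply_op U1 (apply_op y (apply_op V1 x)) + apply_op U2 (Z (apply_op V2 x))" for x
  proof (rule LIMSEQ_unique)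
    show "(\<lambda>n. apply_op (S (Suc n)) x) \<longlonglongrightarrow> Z x"
      using lim by (rule LIMSEQ_Suc)
    show "(\<lambda>n. apply_op (S (Suc n)) x) \<longlonglongrightarrow>
        apply_op U1 (apply_op y (apply_op V1 x)) + apply_op U2 (Z (apply_op V2 x))"
      unfolding S_Suc by (intro tendsto_intros bounded_linear.tendsto[OF lin] lim)
  qed
  have "apply_op (Abs_op Z) = apply_op (U1 * y * V1 + U2 * Abs_op Z * V2)"
    by (rule ext) (unfold add mult apply_Z, rule fixpoint)
  then have "Abs_op Z = U1 * y * V1 + U2 * Abs_op Z * V2"
    unfolding apply_op_inject .
  then show thesis
    by (rule that)
qed

theorem corollary3p17:
  fixes f :: ncpoly and T :: "'h::chilbert_space bounded_op"
  assumes "\<not> cfinite_dim (UNIV :: 'h set)"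
    and "nonconstant f"
  shows "\<exists>g :: nat \<Rightarrow> 'h bounded_op.
    (\<forall>i<3916. g i \<in> {t - t' |t t'. t \<in> ncimage f \<and> t' \<in> ncimage f}) \<and>
    T = (\<Sum>i<3916. g i)"
proof -
  interpret D: similarity_invariant "image_differences f :: 'h bounded_op set"
    by (rule similarity_invariant_image_differences)
  obtain U1 U2 V1 V2 :: "'h bounded_op" where
    UV: "V1 * U1 = 1" "V2 * U2 = 1" "V1 * U2 = 0" "V2 * U1 = 0" "U1 * V1 + U2 * V2 = 1"
    and adj: "\<And>x y. cinner (apply_op U1 x) y = cinner x (apply_op V1 y)"
      "\<And>x y. cinner (apply_op U2 x) y = cinner x (apply_op V2 y)"
    by (rule cuntz_isometries_exist[OF assms(1)]) blast
  \<comment> \<open>\<open>False\<close> stands for the first isometry and \<open>True\<close> for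
    the second, so \<open>seqU n\<close> is \<open>U2^n * U1\<close>.\<close>
  interpret cuntz_pair "\<lambda>b. if b then U2 else U1" "\<lambda>b. if b then V2 else V1"
    by unfold_locales (simp_all add: dual_family_def UV)
  obtain m where "m > 0" and corner: "\<And>y. seqU 0 * y * seqV m \<in> image_differences f"
    using corner_mem_image_differences[OF dual_family_seq assms(2)] by blast
  have "T \<in> sums_of 96 (image_differences f)"
  proof (rule sums_of_similarity_invariant[OF D.similarity_invariant_axioms \<open>m > 0\<close> corner])
    fix y :: "'h bounded_op"
    obtain z where "z = U1 * y * V1 + U2 * z * V2"
      by (rule amplification_exists[OF UV adj])
    then show "\<exists>z. z = (if False then U2 else U1) * y * (if False then V2 else V1)
        + (if True then U2 else U1) * z * (if True then V2 else V1)"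
      by auto
  qed
  \<comment> \<open>Zero is itself a difference of two equal values and fills the sum up to the
    required length.\<close>
  then have "T \<in> sums_of 3916 (image_differences f)"
    by (rule sums_of_mono) (simp_all add: D.zero_mem)
  then show ?thesis
    unfolding sums_of_def image_differences_def by blast
qed

end
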